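(* Let $\Omega$ be a non-empty finite set, and let $\overline{p}\colon\Omega\to[0,1]$ be an upper probability mass function whose associated lower prevision $\underline{P}_{\overline{p}}$ avoids sure loss. Let $f\colon\Omega\to\mathbb{R}$ be a gamble decomposed in terms of its level sets as $$f=\sum_{i=0}^{n}\lambda_iI_{A_i},$$ where $\lambda_0\in\mathbb{R}$, $\lambda_1,\dots,\lambda_n>0$ and $\Omega=A_0\supsetneq A_1\supsetneq\dots\supsetneq A_n\ne\emptyset$. Then $$\overline{E}_{\overline{p}}(f)=\sum_{i=0}^{n}\lambda_i\overline{E}_{\overline{p}}(A_i),$$ where $\overline{E}_{\overline{p}}(A):=\overline{E}_{\overline{p}}(I_A)$ for $A\subseteq\Omega$.
   Context: A gamble is a real-valued function on the finite set $\Omega$; $I_A$ denotes the indicator function of $A\subseteq\Omega$. Inequalities between gambles are pointwise, and constants are identified with constant gambles. An upper probability mass function $\overline{p}\colon\Omega\to[0,1]$ represents the lower prevision $\underline{P}_{\overline{p}}$ with domain $\{-I_{\{\omega\}}\colon\omega\in\Omega\}$ given by $\underline{P}_{\overline{p}}(-I_{\{\omega\}}):=-\overline{p}(\omega)$. A lower prevision $\underline{P}$ (a real-valued function on a set $\operatorname{dom}\underline{P}$ of gambles) avoids sure loss if for all $N\in\mathbb{N}$, all $\mu_1,\dots,\mu_N\ge0$ and all $f_1,\dots,f_N\in\operatorname{dom}\underline{P}$ one has $\max_{\omega\in\Omega}\sum_{i=1}^{N}\mu_i[f_i(\omega)-\underline{P}(f_i)]\ge0$. (For $\underline{P}_{\overline{p}}$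 this is known to be equivalent to $\sum_{\omega\in\Omega}\overline{p}(\omega)\ge1$.) The natural extension of $\underline{P}_{\overline{p}}$ is $\underline{E}_{\overline{p}}(f):=\sup\{\alpha\in\mathbb{R}\colon f-\alpha\ge\sum_{i=1}^{N}\mu_i(f_i-\underline{P}_{\overline{p}}(f_i)),\ N\in\mathbb{N},\ f_i\in\operatorname{dom}\underline{P}_{\overline{p}},\ \mu_i\ge0\}$, and its conjugate, the upper natural extension, is $\overline{E}_{\overline{p}}(f):=-\underline{E}_{\overline{p}}(-f)$. Explicitly, $\overline{E}_{\overline{p}}(f)=\inf\{\beta\in\mathbb{R}\colon \beta-f\ge\sum_{\omega\in\Omega}\mu_\omega(\overline{p}(\omega)-I_{\{\omega\}})\text{ for some }\mu_\omega\ge0\}$. *)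

theory Defs
  imports Complex_Main "HOL-Library.Indicator_Function"
begin

text \<open>The possibility space is the universe of a finite type; a lower prevision is a
  real-valued partial function on gambles, whose domain is its \<^const>\<open>dom\<close>.\<close>

type_synonym 'a gamble = "'a \<Rightarrow> real"

type_synonym 'a lower_prevision = "'a gamble \<rightharpoonup> real"

definition avoids_sure_loss :: "'a::finite lower_prevision \<Rightarrow> bool" where
  "avoids_sure_loss P \<longleftrightarrow>
    (\<forall>(N::nat) (\<mu>::nat \<Rightarrow> real) (g::nat \<Rightarrow> 'a gamble).
      (\<forall>i\<in>{1..N}. 0 \<le> \<mu> i \<and> g i \<in> dom P) \<longrightarrow>
      0 \<le> (MAX \<omega>\<in>UNIV. \<Sum>i=1..N. \<mu> i * (g i \<omega> - the (P (g i)))))"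

definition natural_extension_lower_bounds :: "'a::finite lower_prevision \<Rightarrow> 'a gamble \<Rightarrow> real set" where
  "natural_extension_lower_bounds P f =
    {\<alpha>. \<exists>(N::nat) (\<mu>::nat \<Rightarrow> real) (g::nat \<Rightarrow> 'a gamble).
      (\<forall>i\<in>{1..N}. 0 \<le> \<mu> i \<and> g i \<in> dom P) \<and>
      (\<forall>\<omega>. f \<omega> - \<alpha> \<ge> (\<Sum>i=1..N. \<mu> i * (g i \<omega> - the (P (g i)))))}"

text \<open>The supremum is taken in the reals. If \<open>P\<close> avoids sure loss, it is the supremum of a
  nonempty set that is bounded above (shown below); otherwise its value is unspecified.\<close>

definition natural_extension :: "'a::finite lower_prevision \<Rightarrow> 'a gamble \<Rightarrow> real" where
  "natural_extension P f = Sup (natural_extension_lower_bounds P f)"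

definition upper_natural_extension :: "'a::finite lower_prevision \<Rightarrow> 'a gamble \<Rightarrow> real" where
  "upper_natural_extension P f = - natural_extension P (\<lambda>\<omega>. - f \<omega>)"

definition neg_singleton :: "'a \<Rightarrow> 'a gamble" where
  "neg_singleton \<omega> = (\<lambda>x. - indicator {\<omega>} x)"

text \<open>Since \<open>neg_singleton\<close> is injective, the description operator below picks
  the unique point that the gamble comes from.\<close>

definition upper_pmf_lower_prevision :: "('a::finite \<Rightarrow> real) \<Rightarrow> 'a lower_prevision" where
  "upper_pmf_lower_prevision p =
    (\<lambda>g. if g \<in> range neg_singleton then Some (- p (THE \<omega>. g = neg_singleton \<omega>)) else None)"

lemma neg_singleton_eq_iff [simp]: "neg_singleton a = neg_singleton b \<longleftrightarrow> a = b"
proof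
  assume "neg_singleton a = neg_singleton b"
  then have "neg_singleton a a = neg_singleton b a" by simp
  then show "a = b" by (simp add: neg_singleton_def indicator_def split: if_splits)
qed simp

lemma dom_upper_pmf_lower_prevision [simp]:
  "dom (upper_pmf_lower_prevision p) = range neg_singleton"
  by (auto simp: upper_pmf_lower_prevision_def dom_def)

lemma upper_pmf_lower_prevision_neg_singleton [simp]:
  "upper_pmf_lower_prevision p (neg_singleton \<omega>) = Some (- p \<omega>)"
  by (simp add: upper_pmf_lower_prevision_def)

lemma natural_extension_lower_bounds_nonempty:
  "natural_extension_lower_bounds P f \<noteq> {}"
proof -
  have "Min (range f) \<in> natural_extension_lower_bounds P f"
    unfolding natural_extension_lower_bounds_def
    by (intro CollectI exI[of _ "0::nat"]) simp
  then show ?thesis by blast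
qed

lemma natural_extension_lower_bounds_bdd_above:
  fixes P :: "'a::finite lower_prevision"
  assumes "avoids_sure_loss P"
  shows "bdd_above (natural_extension_lower_bounds P f)"
proof (rule bdd_aboveI)
  fix \<alpha> assume "\<alpha> \<in> natural_extension_lower_bounds P f"
  then obtain N :: nat and \<mu> :: "nat \<Rightarrow> real" and g :: "nat \<Rightarrow> 'a gamble"
    where *: "\<forall>i\<in>{1..N}. 0 \<le> \<mu> i \<and> g i \<in> dom P"
      and le: "\<And>\<omega>. (\<Sum>i=1..N. \<mu> i * (g i \<omega> - the (P (g i)))) \<le> f \<omega> - \<alpha>"
    unfolding natural_extension_lower_bounds_def by blast
  define h where "h = (\<lambda>\<omega>. \<Sum>i=1..N. \<mu> i * (g i \<omega> - the (P (g i))))"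
  have "0 \<le> Max (range h)"
    using assms * unfolding avoids_sure_loss_def h_def by blast
  moreover have "Max (range h) \<in> range h" by (rule Max_in) auto
  ultimately obtain \<omega> where "0 \<le> h \<omega>" by (metis rangeE)
  then have "\<alpha> \<le> f \<omega>" using le[of \<omega>] by (simp add: h_def)
  also have "f \<omega> \<le> Max (range f)" by simp
  finally show "\<alpha> \<le> Max (range f)" .
qed

end

theory Submission
  imports Defs
begin

text \<open>Every value is computed by exhibiting a primal and a dual certificate. The set function
  \<open>A \<mapsto> min 1 (p(A))\<close> is an upper bound because both \<open>p(A)\<close> and \<open>1\<close> are feasible for \<open>I\<^sub>A\<close>, and
  feasible bounds add up. Conversely, for a chain of events there is a single probability mass
  function \<open>q \<le> p\<close> with \<open>q(A) = min 1 (p(A))\<close> simultaneously for all members \<open>A\<close> of the chain: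
  keep \<open>p\<close> on the largest member of mass less than 1 and scale it down on the rest of the smallest
  member of mass at least 1. Its expectation bounds the upper natural extension from below.\<close>

text \<open>Enumerating the finite space turns one weight per point into an admissible list of
  gambles. At \<open>\<omega>\<close> the indicators single out one weight, so the combination
  collapses to the constant \<open>\<Sum>x\<in>UNIV. \<mu> x * p x\<close> minus
  \<open>\<mu> \<omega>\<close>.\<close>

lemma mem_natural_extension_lower_boundsI:
  fixes p :: "'a::finite \<Rightarrow> real"
  assumes "\<And>x. 0 \<le> \<mu> x"
    and "\<And>\<omega>. (\<Sum>x\<in>UNIV. \<mu> x * p x) - \<mu> \<omega> \<le> f \<omega> - \<alpha>"
  shows "\<alpha> \<in> natural_extension_lower_bounds (upper_pmf_lower_prevision p) f"
proof -
  let ?N = "card (UNIV :: 'a set)"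
  obtain h where h: "bij_betw h {1..?N} (UNIV :: 'a set)"
    using ex_bij_betw_nat_finite_1[of "UNIV :: 'a set"] by auto
  have "(\<Sum>i=1..?N. \<mu> (h i) * (neg_singleton (h i) \<omega> + p (h i))) \<le> f \<omega> - \<alpha>" for \<omega>
  proof -
    have "(\<Sum>i=1..?N. \<mu> (h i) * (neg_singleton (h i) \<omega> + p (h i)))
        = (\<Sum>x\<in>UNIV. \<mu> x * (neg_singleton x \<omega> + p x))"
      using sum.reindex_bij_betw[OF h, of "\<lambda>x. \<mu> x * (neg_singleton x \<omega> + p x)"] .
    also have "\<dots> = (\<Sum>x\<in>UNIV. \<mu> x * p x - (if \<omega> = x then \<mu> x else 0))"
      by (intro sum.cong) (auto simp: neg_singleton_def indicator_def algebra_simps)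
    also have "\<dots> = (\<Sum>x\<in>UNIV. \<mu> x * p x) - \<mu> \<omega>"
      by (simp add: sum_subtractf sum.delta)
    finally show ?thesis using assms(2)[of \<omega>] by simp
  qed
  then show ?thesis
    unfolding natural_extension_lower_bounds_def
    using assms(1)
    by (intro CollectI exI[of _ "?N"] exI[of _ "\<lambda>i. \<mu> (h i)"]
        exI[of _ "\<lambda>i. neg_singleton (h i)"]) simp
qed

text \<open>With equal weights at all points the combination is a constant. If the total mass were
  below 1, this constant would be negative and scalable at will, so the lower bounds of the zero
  gamble would be unbounded.\<close>

lemma sum_upper_pmf_ge_1:
  fixes p :: "'a::finite \<Rightarrow> real"
  assumes "avoids_sure_loss (upper_pmf_lower_prevision p)"
  shows "1 \<le> (\<Sum>x\<in>UNIV. p x)"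
proof (rule ccontr)
  let ?S = "\<Sum>x\<in>UNIV. p x"
  assume "\<not> 1 \<le> ?S"
  then have S: "0 < 1 - ?S" by simp
  obtain M where M: "\<And>\<alpha>. \<alpha> \<in> natural_extension_lower_bounds (upper_pmf_lower_prevision p) (\<lambda>_. 0)
      \<Longrightarrow> \<alpha> \<le> M"
    using natural_extension_lower_bounds_bdd_above[OF assms] unfolding bdd_above_def by blast
  \<comment> \<open>The common weight for which the constant equals
    \<open>- (\<bar>M\<bar> + 1)\<close>, which certifies a lower bound beyond
    \<open>M\<close>.\<close>
  define t where "t = (\<bar>M\<bar> + 1) / (1 - ?S)"
  have t: "t * (1 - ?S) = \<bar>M\<bar> + 1" "0 \<le> t"
    using S by (simp_all add: t_def)
  have "\<bar>M\<bar> + 1 \<in> natural_extension_lower_bounds (upper_pmf_lower_prevision p) (\<lambda>_. 0)"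
    by (rule mem_natural_extension_lower_boundsI[where \<mu> = "\<lambda>_. t"])
      (use t in \<open>simp_all add: sum_distrib_left[symmetric] algebra_simps\<close>)
  from M[OF this] show False by simp
qed

text \<open>The dual certificate, after conjugation. Avoiding sure loss enters because a real
  supremum dominates the members of its set once that set is bounded above.\<close>

lemma upper_natural_extension_le:
  fixes p :: "'a::finite \<Rightarrow> real"
  assumes "avoids_sure_loss (upper_pmf_lower_prevision p)"
    and "\<And>x. 0 \<le> \<mu> x"
    and "\<And>\<omega>. f \<omega> + (\<Sum>x\<in>UNIV. \<mu> x * p x) \<le> \<beta> + \<mu> \<omega>"
  shows "upper_natural_extension (upper_pmf_lower_prevision p) f \<le> \<beta>"
proof -
  have "- \<beta> \<in> natural_extension_lower_bounds (upper_pmf_lower_prevision p) (\<lambda>\<omega>. - f \<omega>)"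
    by (rule mem_natural_extension_lower_boundsI[where \<mu> = \<mu>])
      (use assms(2,3) in \<open>simp_all add: algebra_simps\<close>)
  then have "- \<beta> \<le> natural_extension (upper_pmf_lower_prevision p) (\<lambda>\<omega>. - f \<omega>)"
    unfolding natural_extension_def
    by (intro cSup_upper natural_extension_lower_bounds_bdd_above[OF assms(1)])
  then show ?thesis by (simp add: upper_natural_extension_def)
qed

text \<open>Weak duality: under \<open>q\<close> the gamble bought at \<open>x\<close> has
  expectation \<open>p x - q x\<close>, which is nonnegative. Taking expectations of the inequality
  that certifies a lower bound \<open>\<alpha>\<close> of \<open>- f\<close> therefore bounds
  \<open>\<alpha>\<close> by the expectation of \<open>- f\<close>.\<close>

lemma expectation_le_upper_natural_extension:
  fixes p q :: "'a::finite \<Rightarrow> real"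
  assumes q: "\<And>x. 0 \<le> q x" "\<And>x. q x \<le> p x" "(\<Sum>x\<in>UNIV. q x) = 1"
  shows "(\<Sum>x\<in>UNIV. q x * f x) \<le> upper_natural_extension (upper_pmf_lower_prevision p) f"
proof -
  have "\<alpha> \<le> - (\<Sum>x\<in>UNIV. q x * f x)"
    if "\<alpha> \<in> natural_extension_lower_bounds (upper_pmf_lower_prevision p) (\<lambda>\<omega>. - f \<omega>)" for \<alpha>
  proof -
    from that obtain N :: nat and \<mu> :: "nat \<Rightarrow> real" and g :: "nat \<Rightarrow> 'a gamble"
      where g: "\<forall>i\<in>{1..N}. 0 \<le> \<mu> i \<and> g i \<in> range neg_singleton"
        and le: "\<And>\<omega>. (\<Sum>i=1..N. \<mu> i * (g i \<omega> - the (upper_pmf_lower_prevision p (g i)))) \<le> - f \<omega> - \<alpha>"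
      unfolding natural_extension_lower_bounds_def by auto
    let ?d = "\<lambda>i \<omega>. g i \<omega> - the (upper_pmf_lower_prevision p (g i))"
    have d: "0 \<le> (\<Sum>\<omega>\<in>UNIV. q \<omega> * ?d i \<omega>)" if "i \<in> {1..N}" for i
    proof -
      from g that obtain x where x: "g i = neg_singleton x" by blast
      have "(\<Sum>\<omega>\<in>UNIV. q \<omega> * ?d i \<omega>) = (\<Sum>\<omega>\<in>UNIV. q \<omega> * p x - (if \<omega> = x then q \<omega> else 0))"
        unfolding x upper_pmf_lower_prevision_neg_singleton
        by (intro sum.cong) (auto simp: neg_singleton_def indicator_def algebra_simps)
      also have "\<dots> = p x - q x"
        by (simp add: sum_subtractf sum_distrib_right[symmetric] q(3))
      finally show ?thesis using q(2)[of x] by simp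
    qed
    have "0 \<le> (\<Sum>i=1..N. \<mu> i * (\<Sum>\<omega>\<in>UNIV. q \<omega> * ?d i \<omega>))"
      by (rule sum_nonneg, rule mult_nonneg_nonneg) (use g d in auto)
    also have "\<dots> = (\<Sum>\<omega>\<in>UNIV. q \<omega> * (\<Sum>i=1..N. \<mu> i * ?d i \<omega>))"
      unfolding sum_distrib_left by (subst sum.swap) (simp add: mult.left_commute)
    also have "\<dots> \<le> (\<Sum>\<omega>\<in>UNIV. q \<omega> * (- f \<omega> - \<alpha>))"
      by (intro sum_mono mult_left_mono le q(1))
    also have "\<dots> = - (\<Sum>\<omega>\<in>UNIV. q \<omega> * f \<omega>) - \<alpha>"
      by (simp add: right_diff_distrib sum_subtractf sum_negf sum_distrib_right[symmetric] q(3))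
    finally show ?thesis by simp
  qed
  then have "natural_extension (upper_pmf_lower_prevision p) (\<lambda>\<omega>. - f \<omega>) \<le> - (\<Sum>x\<in>UNIV. q x * f x)"
    unfolding natural_extension_def
    by (intro cSup_least natural_extension_lower_bounds_nonempty)
  then show ?thesis by (simp add: upper_natural_extension_def)
qed

lemma pmf_below_attaining_chain:
  fixes p :: "'a::finite \<Rightarrow> real"
  assumes p: "\<And>x. 0 \<le> p x" and S: "1 \<le> (\<Sum>x\<in>UNIV. p x)"
    and chain: "subset.chain UNIV \<C>"
  obtains q where "\<And>x. 0 \<le> q x" "\<And>x. q x \<le> p x" "(\<Sum>x\<in>UNIV. q x) = 1"
    "\<And>Z. Z \<in> \<C> \<Longrightarrow> (\<Sum>x\<in>Z. q x) = min 1 (\<Sum>x\<in>Z. p x)"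
proof -
  \<comment> \<open>The added \<open>{}\<close> and \<open>UNIV\<close> are comparable with every
    set and have mass below 1 and at least 1 respectively. Both families are thus nonempty finite
    chains, and contain their union and intersection.\<close>
  define \<X> where "\<X> = {Z \<in> insert {} \<C>. sum p Z < 1}"
  define \<Y> where "\<Y> = {Z \<in> insert UNIV \<C>. 1 \<le> sum p Z}"
  define X where "X = \<Union>\<X>"
  define Y where "Y = \<Inter>\<Y>"
  have mono: "sum p Z \<le> sum p Z'" if "Z \<subseteq> Z'" for Z Z'
    using that by (intro sum_mono2) (auto simp: p)
  have "X \<in> \<X>"
    unfolding X_def
    by (rule Union_in_chain[of _ UNIV]) (use chain in \<open>auto simp: \<X>_def subset_chain_def\<close>)
  then have X: "sum p X < 1" by (simp add: \<X>_def)
  have "Y \<in> \<Y>"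
    unfolding Y_def
    by (rule Inter_in_chain[of _ UNIV]) (use chain S in \<open>auto simp: \<Y>_def subset_chain_def\<close>)
  then have Y: "1 \<le> sum p Y" by (simp add: \<Y>_def)
  have XY: "X \<subseteq> Y"
  proof -
    have "X \<subseteq> Y \<or> Y \<subseteq> X"
      using \<open>X \<in> \<X>\<close> \<open>Y \<in> \<Y>\<close> chain by (auto simp: \<X>_def \<Y>_def subset_chain_def)
    then show ?thesis using mono[of Y X] X Y by auto
  qed
  have split: "sum r Y = sum r X + sum r (Y - X)" for r :: "'a \<Rightarrow> real"
    using sum.subset_diff[OF XY, of r] by simp
  \<comment> \<open>The factor that fills the total mass up to exactly 1. Its denominator is
    positive since \<open>X\<close> has mass below 1 and \<open>Y\<close> at least 1; the latter
    also gives \<open>s \<le> 1\<close>.\<close>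
  define s where "s = (1 - sum p X) / sum p (Y - X)"
  have s: "0 \<le> s" "s \<le> 1" "s * sum p (Y - X) = 1 - sum p X"
    using X Y split[of p] by (auto simp: s_def field_simps)
  define q where "q x = (if x \<in> X then p x else if x \<in> Y then s * p x else 0)" for x
  have qY: "sum q Y = 1"
  proof -
    have "sum q Y = sum p X + s * sum p (Y - X)"
      unfolding split sum_distrib_left
      by (intro arg_cong2[where f = "(+)"] sum.cong) (auto simp: q_def)
    then show ?thesis by (simp add: s(3))
  qed
  have q1: "sum q Z = 1" if "Y \<subseteq> Z" for Z
  proof -
    have "sum q Z = sum q Y"
      using that XY by (intro sum.mono_neutral_right) (auto simp: q_def)
    then show ?thesis by (simp add: qY)
  qed
  show thesis
  proof (rule that)
    show "0 \<le> q x" "q x \<le> p x" for x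
      using p[of x] s(1,2) by (auto simp: q_def mult_left_le_one_le)
    show "sum q UNIV = 1" by (rule q1) simp
    \<comment> \<open>A light member lies inside \<open>X\<close>, where \<open>q\<close> agrees
      with \<open>p\<close>; a heavy one contains \<open>Y\<close>, which carries all of
      \<open>q\<close>.\<close>
    fix Z assume Z: "Z \<in> \<C>"
    show "sum q Z = min 1 (sum p Z)"
    proof (cases "sum p Z < 1")
      case True
      with Z have "Z \<subseteq> X" unfolding X_def by (intro Union_upper) (simp add: \<X>_def)
      then have "sum q Z = sum p Z" by (intro sum.cong) (auto simp: q_def)
      with True show ?thesis by simp
    next
      case False
      with Z have "Y \<subseteq> Z" unfolding Y_def by (intro Inter_lower) (simp add: \<Y>_def)
      with False show ?thesis by (simp add: q1)
    qed
  qed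
qed

text \<open>The constant \<open>b\<close> stands apart from the sum because it may have any sign,
  while both certificates for the events rely on nonnegative coefficients.\<close>

lemma upper_natural_extension_chain_sum:
  fixes p :: "'a::finite \<Rightarrow> real" and A :: "'i \<Rightarrow> 'a set"
  assumes p: "\<And>x. 0 \<le> p x" and asl: "avoids_sure_loss (upper_pmf_lower_prevision p)"
    and I: "finite I" "\<And>i. i \<in> I \<Longrightarrow> 0 \<le> c i" and chain: "subset.chain UNIV (A ` I)"
  shows "upper_natural_extension (upper_pmf_lower_prevision p)
      (\<lambda>\<omega>. b + (\<Sum>i\<in>I. c i * indicator (A i) \<omega>)) = b + (\<Sum>i\<in>I. c i * min 1 (\<Sum>x\<in>A i. p x))"
    (is "?E = ?v")
proof (rule antisym)
  \<comment> \<open>On \<open>J\<close> the cheaper bound of an event is its mass, certified by unit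
    weights on its points; elsewhere it is 1, certified by zero weights. Combining these with
    coefficients \<open>c i\<close> gives \<open>\<mu>\<close>.\<close>
  define J where "J = {i \<in> I. sum p (A i) < 1}"
  define \<mu> where "\<mu> x = (\<Sum>i\<in>J. c i * indicator (A i) x)" for x
  have J: "J \<subseteq> I" "finite J" using I(1) by (auto simp: J_def)
  have swap: "(\<Sum>x\<in>UNIV. (\<Sum>i\<in>K. c i * indicator (A i) x) * r x) = (\<Sum>i\<in>K. c i * sum r (A i))"
    for r :: "'a \<Rightarrow> real" and K
  proof -
    have "(\<Sum>x\<in>UNIV. (\<Sum>i\<in>K. c i * indicator (A i) x) * r x)
        = (\<Sum>i\<in>K. c i * (\<Sum>x\<in>UNIV. indicator (A i) x * r x))"
      unfolding sum_distrib_left sum_distrib_right by (subst sum.swap) (simp add: mult.assoc)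
    then show ?thesis by (simp add: indicator_def if_distrib sum.If_cases cong: if_cong)
  qed
  show "?E \<le> ?v"
  proof (rule upper_natural_extension_le[OF asl, of \<mu>])
    show "0 \<le> \<mu> x" for x
      unfolding \<mu>_def using J I(2) by (intro sum_nonneg) auto
    fix \<omega>
    have "(\<Sum>i\<in>I. c i * indicator (A i) \<omega>) + (\<Sum>i\<in>J. c i * sum p (A i))
        = (\<Sum>i\<in>I. c i * indicator (A i) \<omega> + (if sum p (A i) < 1 then c i * sum p (A i) else 0))"
      unfolding sum.distrib J_def using I(1) by (simp add: sum.inter_filter)
    \<comment> \<open>Termwise this is an equality for indices in \<open>J\<close>, and otherwise
      says that an indicator is at most 1.\<close>
    also have "\<dots> \<le> (\<Sum>i\<in>I. c i * min 1 (sum p (A i))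
        + (if sum p (A i) < 1 then c i * indicator (A i) \<omega> else 0))"
      using I(2) by (intro sum_mono) (auto simp: indicator_def min_def)
    also have "\<dots> = (\<Sum>i\<in>I. c i * min 1 (sum p (A i))) + \<mu> \<omega>"
      unfolding sum.distrib \<mu>_def J_def using I(1) by (simp add: sum.inter_filter)
    finally show "b + (\<Sum>i\<in>I. c i * indicator (A i) \<omega>) + (\<Sum>x\<in>UNIV. \<mu> x * p x) \<le> ?v + \<mu> \<omega>"
      unfolding \<mu>_def swap by simp
  qed
  \<comment> \<open>One \<open>q\<close> attains the values of all events at once, so linearity of
    its expectation gives the reverse of subadditivity.\<close>
  obtain q where q: "\<And>x. 0 \<le> q x" "\<And>x. q x \<le> p x" "sum q UNIV = 1"
    and qA: "\<And>Z. Z \<in> A ` I \<Longrightarrow> sum q Z = min 1 (sum p Z)"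
    using pmf_below_attaining_chain[OF p sum_upper_pmf_ge_1[OF asl] chain] by metis
  have "?v = b + (\<Sum>i\<in>I. c i * sum q (A i))"
    by (simp add: qA)
  also have "\<dots> = (\<Sum>x\<in>UNIV. q x * b) + (\<Sum>x\<in>UNIV. q x * (\<Sum>i\<in>I. c i * indicator (A i) x))"
    unfolding swap[symmetric] sum_distrib_right[symmetric] q(3) by (simp add: mult.commute)
  also have "\<dots> = (\<Sum>x\<in>UNIV. q x * (b + (\<Sum>i\<in>I. c i * indicator (A i) x)))"
    by (simp add: distrib_left sum.distrib)
  also have "\<dots> \<le> ?E"
    by (rule expectation_le_upper_natural_extension[OF q])
  finally show "?v \<le> ?E" .
qed

lemma upper_natural_extension_indicator:
  fixes p :: "'a::finite \<Rightarrow> real"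
  assumes "\<And>x. 0 \<le> p x" and "avoids_sure_loss (upper_pmf_lower_prevision p)"
  shows "upper_natural_extension (upper_pmf_lower_prevision p) (indicator A)
    = min 1 (\<Sum>x\<in>A. p x)"
  \<comment> \<open>A single event is a chain with one member.\<close>
  using upper_natural_extension_chain_sum[OF assms, of "{()}" "\<lambda>_. 1" "\<lambda>_. A" 0]
  by (simp add: subset_chain_def)

theorem corollary1:
  fixes p :: "'a::finite \<Rightarrow> real" and f :: "'a gamble"
    and n :: nat and c :: "nat \<Rightarrow> real" and A :: "nat \<Rightarrow> 'a set"
  assumes "\<And>\<omega>. p \<omega> \<in> {0..1}"
    and "avoids_sure_loss (upper_pmf_lower_prevision p)"
    and "f = (\<lambda>\<omega>. \<Sum>i=0..n. c i * indicator (A i) \<omega>)"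
    and "\<And>i. i \<in> {1..n} \<Longrightarrow> c i > 0"
    and "A 0 = UNIV"
    and "\<And>i. i < n \<Longrightarrow> A (Suc i) \<subset> A i"
    and "A n \<noteq> {}"
  shows "upper_natural_extension (upper_pmf_lower_prevision p) f =
    (\<Sum>i=0..n. c i * upper_natural_extension (upper_pmf_lower_prevision p) (indicator (A i)))"
proof -
  have p: "0 \<le> p x" for x using assms(1)[of x] by simp
  have "A j \<subseteq> A i" if "i \<le> j" "j \<le> n" for i j
    using that
  proof (induction j rule: dec_induct)
    case (step k)
    then show ?case using assms(6)[of k] by simp
  qed simp
  then have chain: "subset.chain UNIV (A ` {1..n})"
    unfolding subset_chain_def by auto (meson nat_le_linear subsetD)
  \<comment> \<open>The coefficient \<open>c 0\<close> may be negative, so the term of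
    \<open>A 0 = UNIV\<close> is split off as the constant.\<close>
  have f: "f = (\<lambda>\<omega>. c 0 + (\<Sum>i\<in>{1..n}. c i * indicator (A i) \<omega>))"
    unfolding assms(3) by (simp add: sum.atLeast_Suc_atMost assms(5))
  have "upper_natural_extension (upper_pmf_lower_prevision p) f
      = c 0 + (\<Sum>i\<in>{1..n}. c i * min 1 (\<Sum>x\<in>A i. p x))"
    unfolding f
    by (rule upper_natural_extension_chain_sum[OF p assms(2) _ _ chain]) (auto simp: assms(4) less_imp_le)
  \<comment> \<open>The constant rejoins the sum because \<open>UNIV\<close> has mass at least 1,
    which makes its minimum equal to 1.\<close>
  also have "\<dots> = (\<Sum>i=0..n. c i * min 1 (\<Sum>x\<in>A i. p x))"
    using sum_upper_pmf_ge_1[OF assms(2)] by (simp add: sum.atLeast_Suc_atMost assms(5))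
  finally show ?thesis
    by (simp add: upper_natural_extension_indicator[OF p assms(2)])
qed

end
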